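(* Let $p$ be an odd prime, let $m$ and $k$ be positive integers, let $q=p^m$, and assume $\gcd(k,q+1)=1$. Let $F(x)=x^{k(q-1)}$ be the power mapping over $\mathbb{F}_{q^2}$. If $q\equiv 2\pmod 3$, the boomerang spectrum of $F$ is \[\Big\{\nu_{0}=\tfrac{q^2-1}{2}+2q-6,\ \nu_{2}=\tfrac{q^2-1}{2}-2q+6\Big\}.\] If $q\not\equiv 2\pmod 3$, the boomerang spectrum of $F$ is \[\Big\{\nu_{0}=\tfrac{q^2-1}{2}+2(q-1),\ \nu_{2}=\tfrac{q^2-1}{2}-2(q-1)\Big\}.\]
   Context: For a function $F:\mathbb{F}_{p^n}\to\mathbb{F}_{p^n}$ and $a,b\in\mathbb{F}_{p^n}^*$, let $\beta_F(a,b)$ be the number of pairs $(x,y)\in\mathbb{F}_{p^n}^2$ satisfying both $F(x)-F(y)=b$ and $F(x+a)-F(y+a)=b$. Here $n=2m$ and $F(0)=0$. For a power mapping $F$, the boomerang spectrum is the list of the numbers $\nu_i=|\{b\in\mathbb{F}_{p^n}^*:\beta_F(1,b)=i\}|$; values $i$ not listed have $\nu_i=0$. *)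

theory Defs
  imports Complex_Main "HOL-Computational_Algebra.Primes"
begin

definition boomerang_count :: "('a::{field,finite} \<Rightarrow> 'a) \<Rightarrow> 'a \<Rightarrow> 'a \<Rightarrow> nat" where
  "boomerang_count F a b = card {(x, y). F x - F y = b \<and> F (x + a) - F (y + a) = b}"

(* For a power mapping F the shift a = 1 determines the counts for all nonzero shifts;
   the spectrum is the function mapping i to nu_i, for every i. *)
definition boomerang_spectrum :: "('a::{field,finite} \<Rightarrow> 'a) \<Rightarrow> nat \<Rightarrow> nat" where
  "boomerang_spectrum F i = card {b. b \<noteq> 0 \<and> boomerang_count F 1 b = i}"

end

theory Submission
  imports Defs "HOL-Computational_Algebra.Polynomial"
begin

text \<open>
  Put \<open>g x = x ^ (q - 1)\<close>, which maps nonzero elements into the group \<open>U\<close> of \<open>(q + 1)\<close>-st roots of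
  unity, on which \<open>k\<close>-th powers are injective. Since \<open>g x * x = x ^ q\<close> is additive in \<open>x\<close>, an
  element \<open>x\<close> is determined by \<open>g x\<close> and \<open>g (x + 1)\<close> unless both are \<open>1\<close>. A nonzero difference \<open>s - t\<close> of
  elements of \<open>U\<close> determines the product \<open>s * t\<close>, hence the pair up to \<open>(s, t) \<mapsto> (- t, - s)\<close>.
  So a solution \<open>(x, y)\<close> of the boomerang system with nonzero \<open>b\<close> with \<open>x, y \<notin> {0, - 1}\<close>
  satisfies \<open>g (x + 1) = - g y\<close> and \<open>g (y + 1) = - g x\<close>; such solutions correspond to pairs
  \<open>(u, v)\<close> in \<open>U - {1, - 1}\<close> with \<open>u \<noteq> v\<close> and \<open>u \<noteq> - v\<close>, so \<open>k\<close> plays no role. The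
  remaining solutions come from the primitive cube roots of unity in \<open>U\<close>, which exist iff \<open>3\<close>
  divides \<open>q + 1\<close>. For fixed \<open>b\<close> the solutions, if any, form a single orbit of the fixed-point-free
  reflection \<open>(x, y) \<mapsto> (- 1 - x, - 1 - y)\<close>, so that \<open>\<nu>\<^sub>2\<close> is half the number of solutions over
  all nonzero \<open>b\<close>.
\<close>

section \<open>Finite fields: power equations, characteristic, roots of unity\<close>

lemma card_power_eq_le:
  fixes c :: "'a::{field,finite}"
  assumes "n > 0"
  shows "card {x. x ^ n = c} \<le> n"
proof -
  define P where "P = monom (1 :: 'a) n + [:- c:]"
  have "degree P = n"
    unfolding P_def using assms by (subst degree_add_eq_left) (auto simp: degree_monom_eq)
  moreover have "P \<noteq> 0"
    using \<open>degree P = n\<close> assms by auto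
  moreover have "{x. poly P x = 0} = {x. x ^ n = c}"
    by (auto simp: P_def poly_monom)
  ultimately show ?thesis
    using card_poly_roots_bound[of P] by simp
qed

text \<open>Multiplication by \<open>x\<close> permutes the nonzero elements, so it leaves their
  product unchanged.\<close>

lemma power_card_minus_one_eq_1:
  fixes x :: "'a::{field,finite}"
  assumes "x \<noteq> 0"
  shows "x ^ (card (UNIV :: 'a set) - 1) = 1"
proof -
  have "(\<Prod>y\<in>UNIV - {0}. x * y) = \<Prod>(UNIV - {0})"
    by (rule prod.reindex_bij_witness[of _ "\<lambda>y. y / x" "\<lambda>y. x * y"]) (use assms in auto)
  then have "x ^ (card (UNIV :: 'a set) - 1) * \<Prod>(UNIV - {0}) = \<Prod>(UNIV - {0 :: 'a})"
    by (simp add: prod.distrib card_Diff_singleton)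
  moreover have "\<Prod>(UNIV - {0 :: 'a}) \<noteq> 0"
    by simp
  ultimately show ?thesis
    by simp
qed

text \<open>Translation by 1 permutes the field, so it leaves the sum of all elements
  unchanged.\<close>

lemma of_nat_card_UNIV_eq_0: "of_nat (card (UNIV :: 'a set)) = (0 :: 'a::{field,finite})"
proof -
  have "(\<Sum>x::'a\<in>UNIV. x + 1) = \<Sum>UNIV"
    by (rule sum.reindex_bij_witness[of _ "\<lambda>x. x - 1" "\<lambda>x. x + 1"]) auto
  then show ?thesis
    by (simp add: sum.distrib)
qed

lemma CHAR_eq_prime:
  assumes "prime p" and "card (UNIV :: 'a::{field,finite} set) = p ^ n"
  shows "CHAR('a) = p"
proof -
  have "CHAR('a) dvd p ^ n"
    using of_nat_card_UNIV_eq_0[where 'a = 'a] assms(2) of_nat_eq_0_iff_char_dvd by metis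
  moreover have "prime CHAR('a)"
    by (intro prime_CHAR_semidom finite_imp_CHAR_pos) auto
  ultimately show ?thesis
    using assms(1) prime_dvd_power primes_dvd_imp_eq by blast
qed

text \<open>The map \<open>x \<mapsto> x ^ e\<close> sends the \<open>d * e\<close> nonzero elements
  into the \<open>d\<close>-th roots of unity, with fibres of size at most \<open>e\<close>. So
  there are at least \<open>d\<close> roots; the polynomial bound gives at most
  \<open>d\<close>.\<close>

lemma card_roots_of_unity:
  assumes "d dvd card (UNIV :: 'a::{field,finite} set) - 1"
  shows "card {x :: 'a. x ^ d = 1} = d"
proof -
  obtain e where e: "card (UNIV :: 'a set) - 1 = d * e"
    using assms by blast
  have "card {0, 1 :: 'a} \<le> card (UNIV :: 'a set)"
    by (rule card_mono) auto
  then have pos: "d > 0" "e > 0"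
    using e by (auto intro: gr0I)
  define B where "B = {x :: 'a. x ^ d = 1}"
  have "x ^ e \<in> B" if "x \<noteq> 0" for x :: 'a
    using power_card_minus_one_eq_1[OF that] unfolding B_def e by (simp flip: power_mult add: mult.commute)
  then have "UNIV - {0 :: 'a} \<subseteq> (\<Union>c\<in>B. {x. x ^ e = c})"
    by auto
  then have "card (UNIV - {0 :: 'a}) \<le> card (\<Union>c\<in>B. {x. x ^ e = c})"
    by (rule card_mono[rotated]) auto
  also have "\<dots> \<le> (\<Sum>c\<in>B. card {x. x ^ e = c})"
    by (rule card_UN_le) simp
  also have "\<dots> \<le> (\<Sum>c\<in>B. e)"
    by (rule sum_mono) (rule card_power_eq_le[OF pos(2)])
  finally have "d \<le> card B"
    using e pos by (simp add: card_Diff_singleton)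
  moreover have "card B \<le> d"
    unfolding B_def by (rule card_power_eq_le[OF pos(1)])
  ultimately show ?thesis
    by (simp add: B_def)
qed

section \<open>Setting, and the group of \<open>(q + 1)\<close>-st roots of unity\<close>

locale quadratic_power_map =
  fixes p m k q :: nat and F :: "'a::{field,finite} \<Rightarrow> 'a"
  assumes prime_p: "prime p" and odd_p: "odd p" and m_pos: "m > 0"
    and q_def: "q = p ^ m"
    and card_UNIV_q: "card (UNIV :: 'a set) = q\<^sup>2"
    and gcd_k: "gcd k (q + 1) = 1"
    and F_def: "F = (\<lambda>x. x ^ (k * (q - 1)))"
    and k_pos: "k > 0"
begin

lemma odd_q: "odd q"
  using odd_p by (simp add: q_def)

lemma q_ge_3: "q \<ge> 3"
proof -
  have "p \<ge> 3"
    using prime_ge_2_nat[OF prime_p] odd_p by (cases "p = 2") auto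
  also have "p \<le> q"
    using m_pos prime_gt_0_nat[OF prime_p] by (simp add: q_def self_le_power)
  finally show ?thesis .
qed

lemma CHAR_eq: "CHAR('a) = p"
  by (rule CHAR_eq_prime[of p "m * 2"]) (simp_all add: prime_p card_UNIV_q q_def power_mult)

lemma two_neq_0: "(2 :: 'a) \<noteq> 0"
proof
  assume "(2 :: 'a) = 0"
  then have "p dvd 2"
    using of_nat_eq_0_iff_char_dvd[of 2, where 'a = 'a] by (simp add: CHAR_eq)
  with odd_p prime_p show False
    by (metis primes_dvd_imp_eq two_is_prime_nat even_numeral dvd_refl)
qed

lemma uminus_neq_self: "x \<noteq> 0 \<Longrightarrow> - x \<noteq> (x :: 'a)"
  using two_neq_0 by (metis add.right_inverse mult_2 no_zero_divisors)

lemma minus_one_neq_one: "- 1 \<noteq> (1 :: 'a)"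
  by (rule uminus_neq_self) simp

lemma frobenius_add: "(x + y :: 'a) ^ q = x ^ q + y ^ q"
  by (rule freshmans_dream'[where n = m]) (simp_all add: prime_p CHAR_eq q_def)

text \<open>\<open>q + 1\<close> is even and coprime to \<open>k\<close>. Oddness makes
  \<open>k\<close>-th powers respect signs.\<close>

lemma odd_k: "odd k"
  using gcd_k odd_q by (metis even_plus_one_iff gcd_greatest nat_dvd_1_iff_1 numeral_eq_one_iff semiring_norm(85))

definition U :: "'a set" where
  "U = {u. u ^ (q + 1) = 1}"

definition g :: "'a \<Rightarrow> 'a" where
  "g x = x ^ (q - 1)"

lemma F_eq: "F x = g x ^ k"
  by (simp add: F_def g_def mult.commute flip: power_mult)

lemma g_mult_self: "g x * x = x ^ q"
  using q_ge_3 by (metis Suc_diff_1 g_def less_le_trans power_Suc2 zero_less_numeral)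

lemma g_0 [simp]: "g 0 = 0" and g_1 [simp]: "g 1 = 1"
  using q_ge_3 by (simp_all add: g_def)

lemma g_uminus [simp]: "g (- x) = g x"
  using odd_q by (simp add: g_def)

lemma F_0 [simp]: "F 0 = 0" and F_1 [simp]: "F 1 = 1" and F_uminus [simp]: "F (- x) = F x"
  using k_pos by (simp_all add: F_eq)

lemma uminus_power_k: "(- x) ^ k = - (x ^ k :: 'a)"
  using odd_k by simp

lemma g_eqI: "x \<noteq> 0 \<Longrightarrow> x ^ q = u * x \<Longrightarrow> g x = u"
  by (metis g_mult_self mult_right_cancel)

lemma U_iff: "u \<in> U \<longleftrightarrow> u ^ q * u = 1"
  by (simp add: U_def mult.commute)

lemma U_nonzero: "u \<in> U \<Longrightarrow> u \<noteq> 0"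
  using q_ge_3 by (auto simp: U_iff)

lemma U_power_q: "u \<in> U \<Longrightarrow> u ^ q = inverse u"
  by (metis U_iff inverse_unique mult.commute)

lemma U_power: "u \<in> U \<Longrightarrow> u ^ n \<in> U"
  unfolding U_def mem_Collect_eq by (metis power_mult mult.commute power_one)

lemma U_uminus: "- u \<in> U \<longleftrightarrow> u \<in> U"
  using odd_q by (simp add: U_def)

lemma one_in_U: "1 \<in> U"
  by (simp add: U_def)

lemma g_in_U: "x \<noteq> 0 \<Longrightarrow> g x \<in> U"
proof -
  assume "x \<noteq> 0"
  have "(q - 1) * (q + 1) = q\<^sup>2 - 1"
    by (simp add: power2_eq_square algebra_simps)
  with power_card_minus_one_eq_1[OF \<open>x \<noteq> 0\<close>] show ?thesis
    unfolding U_def g_def card_UNIV_q mem_Collect_eq by (simp only: flip: power_mult)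
qed

lemma F_in_U: "x \<noteq> 0 \<Longrightarrow> F x \<in> U"
  by (simp add: F_eq U_power g_in_U)

lemma F_eq_0_iff: "F x = 0 \<longleftrightarrow> x = 0"
  using F_in_U U_nonzero by fastforce

text \<open>Bezout gives an inverse \<open>a\<close> of \<open>k\<close> modulo
  \<open>q + 1\<close>, and the \<open>a\<close>-th power undoes the \<open>k\<close>-th on
  \<open>U\<close>.\<close>

lemma power_k_inj:
  assumes "u \<in> U" "v \<in> U" "u ^ k = v ^ k"
  shows "u = v"
proof -
  obtain a c where ac: "k * a = (q + 1) * c + 1"
    using bezout_nat[of k "q + 1"] k_pos gcd_k by auto
  have "(w ^ k) ^ a = w" if "w \<in> U" for w
  proof -
    have "(w ^ k) ^ a = (w ^ (q + 1)) ^ c * w"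
      by (metis ac power_add power_mult power_one_right)
    with that show ?thesis
      unfolding U_def by (simp only: mem_Collect_eq power_one mult_1)
  qed
  with assms show ?thesis by metis
qed

lemma card_U: "card U = q + 1"
proof -
  have "card (UNIV :: 'a set) - 1 = (q + 1) * (q - 1)"
    unfolding card_UNIV_q by (simp add: power2_eq_square algebra_simps)
  then show ?thesis
    unfolding U_def by (intro card_roots_of_unity) (metis dvd_triv_left)
qed

section \<open>Recovering arguments from values and pairs from differences\<close>

lemma F_eq_iff_g_eq: "F x = F y \<longleftrightarrow> g x = g y"
proof
  assume eq: "F x = F y"
  show "g x = g y"
  proof (cases "x = 0 \<or> y = 0")
    case True
    then have "x = 0" "y = 0" using eq F_eq_0_iff F_0 by metis+
    then show ?thesis by simp
  next
    case False
    then show ?thesis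
      using eq power_k_inj g_in_U by (simp add: F_eq)
  qed
qed (simp add: F_eq)

text \<open>Conjugating \<open>x + 1\<close> gives \<open>g x * x + 1 = g (x + 1) * (x + 1)\<close>, a linear equation for \<open>x\<close>.\<close>
lemma g_linear: "x * (g x - g (x + 1)) = g (x + 1) - 1"
proof -
  have "g (x + 1) * (x + 1) = g x * x + 1"
    by (simp add: g_mult_self frobenius_add)
  then show ?thesis
    by (simp add: algebra_simps)
qed

lemma g_eq_shift_imp_1: "g x = g (x + 1) \<Longrightarrow> g x = 1"
  using g_linear[of x] by simp

text \<open>By \<open>g_linear\<close> the point is determined once the coefficient
  \<open>g x - g (x + 1)\<close> is nonzero, and it vanishes only if both values are 1.\<close>

lemma F_pair_inj:
  assumes "F x = F y" "F (x + 1) = F (y + 1)" "\<not> (F x = 1 \<and> F (x + 1) = 1)"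
  shows "x = y"
proof -
  have eq: "g x = g y" "g (x + 1) = g (y + 1)"
    using assms by (simp_all add: F_eq_iff_g_eq)
  have "g x \<noteq> g (x + 1)"
    using g_eq_shift_imp_1[of x] assms(3) by (auto simp: F_eq)
  moreover have "x * (g x - g (x + 1)) = y * (g x - g (x + 1))"
    using g_linear[of x] g_linear[of y] eq by simp
  ultimately show ?thesis
    by simp
qed

text \<open>Conjugation inverts elements of \<open>U\<close>, so \<open>d = s - t\<close> has
  conjugate \<open>- d / (s * t)\<close>, which fixes \<open>s * t\<close>. Then \<open>s'\<close>
  is a root of the quadratic \<open>X^2 - d X - s t\<close> with roots \<open>s\<close> and
  \<open>- t\<close>.\<close>

lemma U_diff_unique:
  assumes U: "s \<in> U" "t \<in> U" "s' \<in> U" "t' \<in> U"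
    and eq: "s - t = s' - t'" and neq: "s \<noteq> t"
  shows "s' = s \<and> t' = t \<or> s' = - t \<and> t' = - s"
proof -
  have conj: "(s - t) ^ q = - (s - t) / (s * t)" if "s \<in> U" "t \<in> U" for s t
  proof -
    have "s ^ q = (s - t) ^ q + t ^ q"
      using frobenius_add[of "s - t" t] by simp
    with that show ?thesis
      using U_nonzero by (simp add: U_power_q field_simps)
  qed
  have "- (s - t) / (s * t) = - (s - t) / (s' * t')"
    using conj[OF U(1,2)] conj[OF U(3,4)] unfolding eq by (rule trans[OF sym])
  then have st: "s * t = s' * t'"
    using neq by (metis divide_cancel_left neg_equal_0_iff_equal right_minus_eq)
  have "t' = s' - (s - t)" using eq by (simp add: algebra_simps)
  then have "(s' - s) * (s' + t) = 0"
    using st by algebra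
  then have "s' = s \<or> s' = - t"
    by (simp add: eq_neg_iff_add_eq_0)
  then show ?thesis
    using \<open>t' = s' - (s - t)\<close> by auto
qed

section \<open>The solution set and its symmetries\<close>

text \<open>Collects the solutions for all nonzero \<open>b\<close> at once; \<open>b\<close> is
  recovered as \<open>F x - F y\<close>.\<close>

definition T :: "('a \<times> 'a) set" where
  "T = {(x, y). F x - F y = F (x + 1) - F (y + 1) \<and> F x \<noteq> F y}"

lemma F_reflect: "F (- 1 - x) = F (x + 1)" "F (- x) = F x"
proof -
  have "- 1 - x = - (x + 1)" by simp
  then show "F (- 1 - x) = F (x + 1)" by (metis F_uminus)
qed simp

text \<open>As \<open>F\<close> is even, the reflection exchanges the values at \<open>x\<close> and
  \<open>x + 1\<close>, hence the two sides of the equation.\<close>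

lemma reflect_T_iff: "(- 1 - x, - 1 - y) \<in> T \<longleftrightarrow> (x, y) \<in> T"
  by (auto simp: T_def F_reflect)

lemma swap_T_iff: "(y, x) \<in> T \<longleftrightarrow> (x, y) \<in> T"
  by (auto simp: T_def algebra_simps)

lemma T_zero:
  assumes "(0, y) \<in> T"
  shows "y \<noteq> 0" "y \<noteq> - 1"
proof -
  have T: "- F y = 1 - F (y + 1)" "F y \<noteq> 0"
    using assms by (simp_all add: T_def)
  then show "y \<noteq> 0"
    using F_0 by blast
  show "y \<noteq> - 1"
  proof
    assume "y = - 1"
    with T(1) have "- 1 = (1 :: 'a)" by simp
    with minus_one_neq_one show False by contradiction
  qed
qed

text \<open>All four values lie in \<open>U\<close>, so the two equal differences have the same or
  flipped entries. The first option forces \<open>g x = g y = 1\<close>, against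
  \<open>F x \<noteq> F y\<close>. The exclusions then follow from the linear equations.\<close>

lemma T_generic:
  assumes "(x, y) \<in> T" "x \<notin> {0, - 1}" "y \<notin> {0, - 1}"
  shows "F (x + 1) = - F y" "F (y + 1) = - F x"
    "g (x + 1) = - g y" "g (y + 1) = - g x"
    "g x \<notin> {1, - 1}" "g y \<notin> {1, - 1}" "g x + g y \<noteq> 0"
    "F x \<notin> {1, - 1}" "F y \<notin> {1, - 1}"
    "x * (g x + g y) = - g y - 1" "y * (g x + g y) = - g x - 1"
proof -
  have nz: "x \<noteq> 0" "y \<noteq> 0" "x + 1 \<noteq> 0" "y + 1 \<noteq> 0"
    using assms by (auto simp: add_eq_0_iff2)
  have T: "F x - F y = F (x + 1) - F (y + 1)" "F x \<noteq> F y"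
    using assms(1) by (auto simp: T_def)
  have "\<not> (F (x + 1) = F x \<and> F (y + 1) = F y)"
    using T(2) g_eq_shift_imp_1[of x] g_eq_shift_imp_1[of y] F_eq_iff_g_eq by metis
  then show A: "F (x + 1) = - F y" "F (y + 1) = - F x"
    using U_diff_unique[OF F_in_U F_in_U F_in_U F_in_U T] nz by auto
  have "g (x + 1) ^ k = (- g y) ^ k" "g (y + 1) ^ k = (- g x) ^ k"
    using A by (simp_all add: F_eq uminus_power_k)
  then show G: "g (x + 1) = - g y" "g (y + 1) = - g x"
    using nz by (metis power_k_inj g_in_U U_uminus)+
  show nL: "x * (g x + g y) = - g y - 1" "y * (g x + g y) = - g x - 1"
    using g_linear[of x] g_linear[of y] unfolding G by (simp_all add: add.commute)
  have nM: "(x + 1) * (g x + g y) = g x - 1" "(y + 1) * (g x + g y) = g y - 1"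
    by (simp_all only: distrib_right[of _ 1] nL) simp_all
  show ne: "g x + g y \<noteq> 0"
  proof
    assume "g x + g y = 0"
    with nM have "g x = 1" "g y = 1" by simp_all
    with T(2) show False by (simp add: F_eq)
  qed
  show pm: "g x \<notin> {1, - 1}" "g y \<notin> {1, - 1}"
  proof -
    have "g x \<noteq> 1" "g y \<noteq> 1"
      using nM ne nz by (metis diff_self mult_eq_0_iff)+
    moreover have "g x \<noteq> - 1" "g y \<noteq> - 1"
      using nL ne nz by (metis add.inverse_inverse diff_self mult_eq_0_iff)+
    ultimately show "g x \<notin> {1, - 1}" "g y \<notin> {1, - 1}" by simp_all
  qed
  \<comment> \<open>As \<open>k\<close> is odd, 1 and \<open>- 1\<close> are their own
    \<open>k\<close>-th powers, and no other element of \<open>U\<close> shares these.\<close>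
  have F1: "F z \<notin> {1, - 1}" if "g z \<in> U" "g z \<notin> {1, - 1}" for z
  proof -
    have "- 1 \<in> U"
      using one_in_U by (simp only: U_uminus)
    then have "g z ^ k \<noteq> 1 ^ k" "g z ^ k \<noteq> (- 1) ^ k"
      using that power_k_inj[of "g z"] one_in_U by blast+
    then show ?thesis
      unfolding F_eq uminus_power_k power_one by blast
  qed
  then show "F x \<notin> {1, - 1}" "F y \<notin> {1, - 1}"
    using pm g_in_U nz by blast+
qed

text \<open>Otherwise \<open>F (y + 1) = - 2\<close>, so 2 lies in \<open>U\<close>; being fixed by
  conjugation it satisfies \<open>2 * 2 = 1\<close>. In the resulting characteristic 3,
  \<open>- 2 = 1\<close>, and \<open>g_linear\<close> yields \<open>g y = 1\<close>, a
  contradiction.\<close>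

lemma T_minus_one:
  assumes "(- 1, y) \<in> T"
  shows "F y \<noteq> - 1"
proof
  assume Fy: "F y = - 1"
  have "y \<noteq> 0"
    using Fy by auto
  have r: "F (y + 1) = - 2"
    using assms Fy by (simp add: T_def) (metis minus_minus)
  then have "y + 1 \<noteq> 0"
    using two_neq_0 by (metis F_0 neg_0_equal_iff_equal)
  then have "- 2 \<in> U"
    using F_in_U[of "y + 1"] r by simp
  then have "(2 :: 'a) ^ q * 2 = 1"
    unfolding U_uminus by (simp only: U_iff)
  moreover have "(2 :: 'a) ^ q = 2"
    using frobenius_add[of 1 1] by simp
  ultimately have "(2 :: 'a) * 2 - 1 = 0"
    by simp
  then have "(3 :: 'a) = 0"
    by simp
  then have "F (y + 1) = F 1"
    unfolding r F_1 by (simp add: minus_equation_iff[of 2] eq_neg_iff_add_eq_0)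
  then have "g (y + 1) = 1"
    by (simp only: F_eq_iff_g_eq g_1)
  then have "g y = 1"
    using g_linear[of y] \<open>y \<noteq> 0\<close> by simp
  with Fy minus_one_neq_one show False
    by (simp add: F_eq)
qed

section \<open>Solutions with a common difference\<close>

text \<open>Nonzero coordinates put the values of \<open>F\<close> in \<open>U\<close>, where
  \<open>U_diff_unique\<close> leaves two cases: equal values give the same pair, flipped values the
  reflected one. A coordinate \<open>- 1\<close> falls outside \<open>T_generic\<close> and is
  treated separately.\<close>

lemma T_fibre_normal:
  assumes T: "(x, y) \<in> T" "(x', y') \<in> T" and eq: "F x' - F y' = F x - F y"
    and nz: "x \<noteq> 0" "y \<noteq> 0" "x' \<noteq> 0" "y' \<noteq> 0"
  shows "x' = x \<and> y' = y \<or> x' = - 1 - x \<and> y' = - 1 - y"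
proof -
  have m1: "(1 :: 'a) \<noteq> - 1"
    using minus_one_neq_one by metis
  have ne: "F x \<noteq> F y" "F x' \<noteq> F y'"
    using T by (auto simp: T_def)
  have step: "F (x + 1) - F (y + 1) = F x - F y" "F (x' + 1) - F (y' + 1) = F x - F y"
    using T eq by (auto simp: T_def)
  have gen: "x = - 1 \<or> y = - 1 \<or> F (x + 1) = - F y \<and> F (y + 1) = - F x \<and> F x \<notin> {1, - 1} \<and> F y \<notin> {1, - 1}"
    using T_generic[OF T(1)] nz by blast
  have gen': "x' = - 1 \<or> y' = - 1 \<or>
      F (x' + 1) = - F y' \<and> F (y' + 1) = - F x' \<and> F x' \<notin> {1, - 1} \<and> F y' \<notin> {1, - 1}"
    using T_generic[OF T(2)] nz by blast
  consider "F x' = F x" "F y' = F y" | "F x' = - F y" "F y' = - F x"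
    using U_diff_unique[of "F x" "F y" "F x'" "F y'"] nz eq ne F_in_U by metis
  then show ?thesis
  proof cases
    case 1
    consider "x = - 1" | "y = - 1" | "x \<noteq> - 1" "y \<noteq> - 1" by blast
    then show ?thesis
    proof cases
      case 1
      \<comment> \<open>Here \<open>F x' = 1\<close>, which rules out the generic alternative;
        \<open>y' = - 1\<close> would give \<open>F x' = F y'\<close>.\<close>
      then have "x' = - 1"
        using gen' ne \<open>F x' = F x\<close> by auto
      moreover have "y' = y"
      proof (rule F_pair_inj)
        \<comment> \<open>\<open>F (x + 1) = F 0 = 0\<close>, so \<open>F (y + 1)\<close> is minus
          the common difference; likewise for \<open>y'\<close>.\<close>
        have "F (y' + 1) = - (F x - F y)" "F (y + 1) = - (F x - F y)"
          using step unfolding 1 \<open>x' = - 1\<close> by (simp_all add: minus_equation_iff[of "F _"])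
        then show "F (y' + 1) = F (y + 1)" by simp
        show "\<not> (F y' = 1 \<and> F (y' + 1) = 1)"
          using ne 1 \<open>F y' = F y\<close> by simp
      qed fact
      ultimately show ?thesis using 1 by simp
    next
      case 2
      then have "y' = - 1"
        using gen' ne \<open>F y' = F y\<close> by auto
      moreover have "x' = x"
      proof (rule F_pair_inj)
        show "F (x' + 1) = F (x + 1)"
          using step unfolding 2 \<open>y' = - 1\<close> by simp
        show "\<not> (F x' = 1 \<and> F (x' + 1) = 1)"
          using ne 2 \<open>F x' = F x\<close> by simp
      qed fact
      ultimately show ?thesis using 2 by simp
    next
      case 3
      with gen have G: "F (x + 1) = - F y" "F (y + 1) = - F x" "F x \<notin> {1, - 1}" "F y \<notin> {1, - 1}"
        by auto
      then have "F (x' + 1) = - F y'" "F (y' + 1) = - F x'"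
        using gen' 1 by auto
      then have "F (x' + 1) = F (x + 1)" "F (y' + 1) = F (y + 1)"
        using G 1 by simp_all
      moreover have "F x' \<noteq> 1" "F y' \<noteq> 1"
        using G 1 by simp_all
      ultimately have "x' = x" "y' = y"
        using F_pair_inj 1 by metis+
      then show ?thesis by simp
    qed
  next
    case 2
    have "x \<noteq> - 1"
    proof
      assume "x = - 1"
      moreover have "x' = - 1"
        using gen' 2 m1 \<open>x = - 1\<close> by auto
      ultimately show False
        using T_minus_one[of y] T 2 by (simp add: minus_equation_iff)
    qed
    have "y \<noteq> - 1"
    proof
      assume "y = - 1"
      moreover have "y' = - 1"
        using gen' 2 m1 \<open>y = - 1\<close> by auto
      ultimately show False
        using T_minus_one[of x] T swap_T_iff[of x] 2 by (simp add: minus_equation_iff)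
    qed
    from gen \<open>x \<noteq> - 1\<close> \<open>y \<noteq> - 1\<close>
    have G: "F (x + 1) = - F y" "F (y + 1) = - F x" "F x \<notin> {1, - 1}" "F y \<notin> {1, - 1}"
      by auto
    moreover have "x' \<noteq> - 1" "y' \<noteq> - 1"
      using G 2 by (auto simp: minus_equation_iff)
    ultimately have F': "F (x' + 1) = F x" "F (y' + 1) = F y"
      using gen' 2 by auto
    \<comment> \<open>The point \<open>x'\<close> is compared with the reflection of
      \<open>x\<close>, where \<open>F\<close> takes the values \<open>- F y\<close> and
      \<open>F x\<close> in turn.\<close>
    then have "F (x' + 1) = F (- 1 - x + 1)" "F (y' + 1) = F (- 1 - y + 1)"
      by (simp_all add: F_reflect)
    moreover have "F x' = F (- 1 - x)" "F y' = F (- 1 - y)"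
      using G 2 by (simp_all only: F_reflect)
    moreover have "F (x' + 1) \<noteq> 1" "F (y' + 1) \<noteq> 1"
      using G F' by simp_all
    ultimately have "x' = - 1 - x" "y' = - 1 - y"
      using F_pair_inj by metis+
    then show ?thesis by simp
  qed
qed

text \<open>If a coordinate is 0, then by \<open>T_zero\<close> none is \<open>- 1\<close>, so
  reflecting removes every zero coordinate and keeps the difference.\<close>

lemma T_normalise:
  assumes T: "(x, y) \<in> T"
  obtains a b where "(a, b) \<in> T" "a \<noteq> 0" "b \<noteq> 0" "F a - F b = F x - F y"
    "x = a \<and> y = b \<or> x = - 1 - a \<and> y = - 1 - b"
proof (cases "x = 0 \<or> y = 0")
  case False
  with T show ?thesis
    by (intro that[of x y]) simp_all
next
  case True
  have "(y, x) \<in> T"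
    using T by (simp only: swap_T_iff)
  then have "x \<noteq> - 1" "y \<noteq> - 1"
    using True T_zero[of x] T_zero[of y] T by auto
  then have "- 1 - x \<noteq> 0" "- 1 - y \<noteq> 0"
    by (metis diff_eq_diff_eq diff_self right_minus_eq)+
  moreover have "F (- 1 - x) - F (- 1 - y) = F x - F y"
    unfolding F_reflect using T by (simp add: T_def)
  moreover have "(- 1 - x, - 1 - y) \<in> T"
    using T by (simp only: reflect_T_iff)
  ultimately show ?thesis
    by (intro that[of "- 1 - x" "- 1 - y"]) simp_all
qed

lemma T_fibre:
  assumes T: "(x, y) \<in> T" "(x', y') \<in> T" and eq: "F x' - F y' = F x - F y"
  shows "x' = x \<and> y' = y \<or> x' = - 1 - x \<and> y' = - 1 - y"
proof -
  obtain a b where ab: "(a, b) \<in> T" "a \<noteq> 0" "b \<noteq> 0" "F a - F b = F x - F y"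
    and x: "x = a \<and> y = b \<or> x = - 1 - a \<and> y = - 1 - b"
    using T_normalise[OF T(1)] by blast
  obtain a' b' where ab': "(a', b') \<in> T" "a' \<noteq> 0" "b' \<noteq> 0" "F a' - F b' = F x' - F y'"
    and x': "x' = a' \<and> y' = b' \<or> x' = - 1 - a' \<and> y' = - 1 - b'"
    using T_normalise[OF T(2)] by blast
  have "a' = a \<and> b' = b \<or> a' = - 1 - a \<and> b' = - 1 - b"
    using T_fibre_normal[OF ab(1) ab'(1)] ab ab' eq by simp
  with x x' show ?thesis
    by (elim disjE) simp_all
qed

section \<open>From fibres to the spectrum\<close>

definition diff :: "'a \<times> 'a \<Rightarrow> 'a" where
  "diff = (\<lambda>(x, y). F x - F y)"

lemma boomerang_count_eq: "b \<noteq> 0 \<Longrightarrow> boomerang_count F 1 b = card {z \<in> T. diff z = b}"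
  unfolding boomerang_count_def by (rule arg_cong[of _ _ card]) (auto simp: T_def diff_def)

lemma card_fibre:
  assumes "b \<in> diff ` T"
  shows "card {z \<in> T. diff z = b} = 2"
proof -
  obtain x y where xy: "(x, y) \<in> T" "b = F x - F y"
    using assms by (auto simp: diff_def)
  have "{z \<in> T. diff z = b} = {(x, y), (- 1 - x, - 1 - y)}"
  proof
    show "{z \<in> T. diff z = b} \<subseteq> {(x, y), (- 1 - x, - 1 - y)}"
      using T_fibre[OF xy(1)] xy(2) by (auto simp: diff_def)
    have "F (x + 1) - F (y + 1) = F x - F y"
      using xy by (simp add: T_def)
    then show "{(x, y), (- 1 - x, - 1 - y)} \<subseteq> {z \<in> T. diff z = b}"
      using xy reflect_T_iff[of x y] by (simp add: diff_def F_reflect)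
  qed
  \<comment> \<open>A fixed pair would have both coordinates equal to \<open>- 1 / 2\<close>,
    against \<open>F x \<noteq> F y\<close>.\<close>
  moreover have "(x, y) \<noteq> (- 1 - x, - 1 - y)"
  proof
    assume "(x, y) = (- 1 - x, - 1 - y)"
    then have "2 * x = - 1" "2 * y = - 1"
      by (simp_all add: algebra_simps)
    then have "x = y"
      using two_neq_0 by (metis mult_left_cancel)
    with xy(1) show False by (simp add: T_def)
  qed
  ultimately show ?thesis by simp
qed

lemma card_T_eq: "card T = 2 * card (diff ` T)"
proof -
  have "card T = (\<Sum>b\<in>diff ` T. card {z \<in> T. diff z = b})"
    using sum.image_gen[of T "\<lambda>_. 1 :: nat" diff] by simp
  also have "\<dots> = (\<Sum>b\<in>diff ` T. 2)"
    by (intro sum.cong refl card_fibre)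
  finally show ?thesis by simp
qed

lemma boomerang_count_cases:
  "b \<noteq> 0 \<Longrightarrow> boomerang_count F 1 b = (if b \<in> diff ` T then 2 else 0)"
  using card_fibre[of b] by (auto simp: boomerang_count_eq)

lemma spectrum_2: "2 * boomerang_spectrum F 2 = card T"
proof -
  have "0 \<notin> diff ` T"
    by (auto simp: diff_def T_def)
  then have "b \<noteq> 0 \<and> boomerang_count F 1 b = 2 \<longleftrightarrow> b \<in> diff ` T" for b
    by (cases "b = 0") (simp_all add: boomerang_count_cases)
  then have "{b. b \<noteq> 0 \<and> boomerang_count F 1 b = 2} = diff ` T"
    by blast
  then show ?thesis
    by (simp add: boomerang_spectrum_def card_T_eq)
qed

text \<open>Every nonzero \<open>b\<close> has count 0 or 2; the summand 1 stands for
  \<open>b = 0\<close>.\<close>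

lemma spectrum_0: "boomerang_spectrum F 0 + boomerang_spectrum F 2 + 1 = q\<^sup>2"
proof -
  define A where "A i = {b. b \<noteq> 0 \<and> boomerang_count F 1 b = i}" for i
  have "b \<in> A 0 \<union> A 2 \<longleftrightarrow> b \<noteq> 0" for b
    by (cases "b = 0") (simp_all add: A_def boomerang_count_cases)
  then have "UNIV = insert 0 (A 0 \<union> A 2)"
    by blast
  then have "q\<^sup>2 = card (insert 0 (A 0 \<union> A 2))"
    by (simp only: flip: card_UNIV_q)
  also have "\<dots> = card (A 0 \<union> A 2) + 1"
    by (simp add: A_def)
  also have "card (A 0 \<union> A 2) = card (A 0) + card (A 2)"
    by (rule card_Un_disjoint) (auto simp: A_def)
  finally show ?thesis
    by (simp add: boomerang_spectrum_def A_def)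
qed

lemma spectrum_other: "i \<notin> {0, 2} \<Longrightarrow> boomerang_spectrum F i = 0"
  by (auto simp: boomerang_spectrum_def boomerang_count_cases split: if_splits)

section \<open>Counting the generic solutions\<close>

definition V :: "'a set" where
  "V = U - {1, - 1}"

lemma card_V: "card V = q - 1"
  using minus_one_neq_one card_U one_in_U U_uminus[of 1]
  by (simp add: V_def card_Diff_subset card_insert_if)

text \<open>\<open>V\<close> is closed under negation and \<open>u \<noteq> - u\<close>, so exactly
  two elements are removed for each \<open>u\<close>.\<close>

lemma card_pairs: "card (SIGMA u:V. V - {u, - u}) = (q - 1) * (q - 3)"
proof -
  have "card (V - {u, - u}) = q - 3" if "u \<in> V" for u
  proof -
    have "- u \<in> V" "u \<noteq> 0"
      using that U_nonzero by (auto simp: V_def U_uminus minus_equation_iff)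
    then show ?thesis
      using that uminus_neq_self[of u] card_V by (simp add: card_Diff_subset card_insert_if)
  qed
  then show ?thesis
    by (simp add: card_V)
qed

text \<open>The formula for \<open>x\<close> solves the linear equation of \<open>T_generic\<close>
  with \<open>g x = u\<close> and \<open>g y = v\<close>. Inverting \<open>u\<close> and
  \<open>v\<close> by conjugation confirms \<open>x ^ q = u * x\<close>.\<close>

lemma g_of_ratio:
  assumes "u \<in> V" "v \<in> V" "u + v \<noteq> 0" and x: "x = - (v + 1) / (u + v)"
  shows "x \<notin> {0, - 1}" "g x = u" "g (x + 1) = - v"
proof -
  have uv: "u \<noteq> 0" "v \<noteq> 0" "u ^ q = inverse u" "v ^ q = inverse v"
    "u \<noteq> 1" "v \<noteq> - 1" "v \<noteq> 1" "u \<noteq> - 1"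
    using assms U_nonzero U_power_q by (auto simp: V_def)
  have x1: "x + 1 = (u - 1) / (u + v)"
    using assms(3) x by (simp add: field_simps)
  have "u - 1 \<noteq> 0" "v + 1 \<noteq> 0"
    using uv by (metis right_minus_eq, metis eq_neg_iff_add_eq_0)
  then have nz: "x \<noteq> 0" "x + 1 \<noteq> 0"
    unfolding x1 unfolding x divide_eq_0_iff neg_equal_0_iff_equal using assms(3) by simp_all
  then show "x \<notin> {0, - 1}"
    by auto
  have xq: "x ^ q = - (v ^ q + 1) / (u ^ q + v ^ q)"
    unfolding x power_divide frobenius_add using odd_q by (simp add: frobenius_add del: minus_add_distrib)
  also have "\<dots> = - (inverse v + 1) / ((u + v) / (u * v))"
  proof -
    have "inverse u + inverse v = (u + v) / (u * v)"
      using uv(1,2) by (simp add: field_simps)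
    then show ?thesis
      by (simp only: uv(3,4))
  qed
  also have "\<dots> = u * x"
  proof -
    have "inverse v + 1 = (v + 1) / v"
      using uv(2) by (simp add: field_simps)
    then show ?thesis
      unfolding x using uv(1,2) by (simp del: minus_add_distrib)
  qed
  finally have xq: "x ^ q = u * x" .
  then show "g x = u"
    using nz by (intro g_eqI)
  have "x * (u + v) = - (v + 1)"
    using assms(3) x by simp
  then have "(x + 1) ^ q = - v * (x + 1)"
    unfolding frobenius_add xq power_one by algebra
  then show "g (x + 1) = - v"
    using nz by (intro g_eqI)
qed

definition T_gen :: "('a \<times> 'a) set" where
  "T_gen = {(x, y) \<in> T. x \<notin> {0, - 1} \<and> y \<notin> {0, - 1}}"

lemma card_T_gen: "card T_gen = (q - 1) * (q - 3)"
proof -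
  let ?P = "SIGMA u:V. V - {u, - u}"
  define f where "f = (\<lambda>(x :: 'a, y :: 'a). (g x, g y))"
  \<comment> \<open>\<open>h\<close> solves the two linear equations of \<open>T_generic\<close> for
    \<open>x\<close> and \<open>y\<close>.\<close>
  define h where "h = (\<lambda>(u :: 'a, v :: 'a). (- (v + 1) / (u + v), - (u + 1) / (u + v)))"
  have hf: "f z \<in> ?P \<and> h (f z) = z" if "z \<in> T_gen" for z
  proof -
    obtain x y where z: "z = (x, y)" by (cases z)
    then have T: "(x, y) \<in> T" "x \<notin> {0, - 1}" "y \<notin> {0, - 1}"
      using that by (auto simp: T_gen_def)
    note G = T_generic[OF T]
    have "g x \<noteq> g y" "g y \<noteq> - g x"
      using T(1) G(7) by (auto simp: T_def F_eq)
    then have "f z \<in> ?P"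
      using G(5,6) T g_in_U by (simp add: f_def z V_def)
    moreover have "- (g y + 1) / (g x + g y) = x" "- (g x + 1) / (g x + g y) = y"
      using G(7,10,11) by (simp_all add: divide_eq_eq)
    ultimately show ?thesis
      by (simp add: f_def h_def z)
  qed
  have fh: "h w \<in> T_gen \<and> f (h w) = w" if "w \<in> ?P" for w
  proof -
    obtain u v where w: "w = (u, v)" by (cases w)
    with that have uv: "u \<in> V" "v \<in> V" "v \<noteq> u" "u + v \<noteq> 0" "v + u \<noteq> 0"
      by (auto simp: add_eq_0_iff add_eq_0_iff2)
    define x y where "x = - (v + 1) / (u + v)" and "y = - (u + 1) / (v + u)"
    note X = g_of_ratio[OF uv(1,2,4) x_def] and Y = g_of_ratio[OF uv(2,1,5) y_def]
    have "u ^ k \<noteq> v ^ k"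
      using power_k_inj[of u v] uv by (auto simp: V_def)
    then have "(x, y) \<in> T_gen"
      using X Y by (simp add: T_gen_def T_def F_eq uminus_power_k)
    moreover have "h w = (x, y)"
      by (simp only: h_def w x_def y_def prod.case add.commute[of v u])
    ultimately show ?thesis
      using X Y by (simp add: f_def w)
  qed
  have "bij_betw f T_gen ?P"
    by (rule bij_betw_byWitness[where f' = h]) (use hf fh in blast)+
  then show ?thesis
    using bij_betw_same_card card_pairs by metis
qed

section \<open>Solutions through 0 and cube roots of unity\<close>

definition W :: "'a set" where
  "W = {u \<in> U. u ^ 3 = 1 \<and> u \<noteq> 1}"

lemma cube_root_relation: "u ^ 3 = 1 \<Longrightarrow> u \<noteq> 1 \<Longrightarrow> u\<^sup>2 + u + 1 = (0 :: 'a)"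
proof -
  assume "u ^ 3 = 1" "u \<noteq> 1"
  then have "(u - 1) * (u\<^sup>2 + u + 1) = 0"
    by (simp add: algebra_simps power2_eq_square power3_eq_cube)
  with \<open>u \<noteq> 1\<close> show ?thesis by simp
qed

text \<open>The equation says that \<open>s = F y\<close> and \<open>s + 1\<close> both lie in
  \<open>U\<close>, which makes \<open>s\<close> a root of \<open>X^2 + X + 1\<close>. Injectivity
  of \<open>k\<close>-th powers carries this to \<open>u = g y\<close>, and \<open>g_linear\<close>
  then gives \<open>y = - u\<close>.\<close>

lemma T_zero_iff: "(0, y) \<in> T \<longleftrightarrow> - y \<in> W"
proof
  assume T: "(0, y) \<in> T"
  note nz = T_zero[OF T]
  then have nz1: "y + 1 \<noteq> 0"
    by (metis eq_neg_iff_add_eq_0)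
  define s r where "s = F y" and "r = F (y + 1)"
  have "- s = 1 - r"
    using T by (simp add: s_def r_def T_def)
  then have "r = s + 1"
    by (simp add: algebra_simps)
  moreover have "s \<in> U" "r \<in> U"
    unfolding s_def r_def by (rule F_in_U; fact)+
  ultimately have sr: "s \<in> U" "r \<in> U" "r = s + 1"
    by simp_all
  then have nz_sr: "s \<noteq> 0" "r \<noteq> 0"
    by (simp_all add: U_nonzero)
  \<comment> \<open>This is the conjugate of \<open>r = s + 1\<close>.\<close>
  have "inverse r = inverse s + 1"
    using frobenius_add[of s 1] sr by (simp add: U_power_q)
  then have "s = r * r"
    using nz_sr sr(3) by (simp add: field_simps)
  then have rel: "s\<^sup>2 + s + 1 = 0"
    using sr(3) by (simp add: algebra_simps power2_eq_square)
  then have r: "r = - (s\<^sup>2)"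
    using sr(3) by (simp add: eq_neg_iff_add_eq_0 algebra_simps)
  have "s ^ 3 - 1 = (s - 1) * (s\<^sup>2 + s + 1)"
    by (simp add: algebra_simps power2_eq_square power3_eq_cube)
  with rel have s3: "s ^ 3 = 1"
    by simp
  define u where "u = g y"
  have u: "u \<in> U" "u ^ k = s"
    by (simp_all add: u_def s_def F_eq g_in_U nz)
  have "u ^ 3 = 1"
  proof (rule power_k_inj)
    show "(u ^ 3) ^ k = 1 ^ k"
    proof -
      have "(u ^ 3) ^ k = (u ^ k) ^ 3"
        by (metis power_mult mult.commute)
      then show ?thesis
        by (simp only: u s3 power_one)
    qed
  qed (simp_all add: u U_power one_in_U)
  have "g (y + 1) = - (u\<^sup>2)"
  proof (rule power_k_inj)
    show "g (y + 1) ^ k = (- (u\<^sup>2)) ^ k"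
    proof -
      have "(u\<^sup>2) ^ k = (u ^ k)\<^sup>2"
        by (metis power_mult mult.commute)
      then show ?thesis
        using r by (simp only: u uminus_power_k r_def F_eq)
    qed
  qed (simp_all add: u U_power U_uminus g_in_U nz1)
  then have lin: "y * (u + u\<^sup>2) = - (u\<^sup>2) - 1"
    using g_linear[of y] by (simp add: u_def)
  have "u \<noteq> 1"
  proof
    assume "u = 1"
    with lin have "2 * (y + 1) = 0" by (simp add: algebra_simps)
    with two_neq_0 nz1 show False by (metis mult_eq_0_iff)
  qed
  with \<open>u ^ 3 = 1\<close> have "u\<^sup>2 + u + 1 = 0"
    by (rule cube_root_relation)
  then have "u + u\<^sup>2 = - 1" "- (u\<^sup>2) - 1 = u"
    by algebra+
  with lin have "- y = u" by simp
  with u \<open>u ^ 3 = 1\<close> \<open>u \<noteq> 1\<close> show "- y \<in> W"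
    by (simp add: W_def)
next
  assume "- y \<in> W"
  moreover define u where "u = - y"
  ultimately have u: "y = - u" "u \<in> U" "u ^ 3 = 1" "u \<noteq> 1"
    by (simp_all add: W_def)
  note u0 = U_nonzero[OF u(2)]
  have inv: "inverse u = u\<^sup>2"
    using u(3) u0 by (simp add: field_simps power2_eq_square power3_eq_cube)
  \<comment> \<open>Conjugation gives \<open>u ^ q = inverse u\<close>, which is
    \<open>u * u\<close> for a cube root of unity.\<close>
  have "g u = u"
    using u0 u(2,3) inv by (intro g_eqI) (simp_all add: U_power_q power2_eq_square)
  then have gy: "g y = u"
    by (simp add: u)
  have nz1: "y + 1 \<noteq> 0"
    using u by simp
  have "(y + 1) ^ q = 1 - u\<^sup>2"
    unfolding frobenius_add using odd_q inv by (simp add: u U_power_q)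
  also have "\<dots> = - (u\<^sup>2) * (y + 1)"
    using u(3) by (simp add: u algebra_simps power2_eq_square power3_eq_cube)
  finally have gy1: "g (y + 1) = - (u\<^sup>2)"
    using nz1 by (intro g_eqI)
  have "u ^ k \<noteq> 1"
    using power_k_inj[of u 1] u one_in_U by auto
  moreover have "(u ^ k) ^ 3 = 1"
  proof -
    have "(u ^ k) ^ 3 = (u ^ 3) ^ k"
      by (metis power_mult mult.commute)
    then show ?thesis
      by (simp only: u(3) power_one)
  qed
  ultimately have rel: "(u ^ k)\<^sup>2 + u ^ k + 1 = 0"
    by (intro cube_root_relation)
  moreover have "F (y + 1) = - ((u ^ k)\<^sup>2)"
  proof -
    have "(u\<^sup>2) ^ k = (u ^ k)\<^sup>2"
      by (metis power_mult mult.commute)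
    then show ?thesis
      by (simp only: F_eq gy1 uminus_power_k)
  qed
  moreover have "F y = u ^ k"
    by (simp add: F_eq gy)
  moreover have "- (u ^ k) = 1 + (u ^ k)\<^sup>2"
  proof -
    have "- z = 1 + z\<^sup>2" if "z\<^sup>2 + z + 1 = 0" for z :: 'a
      using that by algebra
    from this[OF rel] show ?thesis .
  qed
  ultimately show "(0, y) \<in> T"
    using u0 by (simp add: T_def)
qed

text \<open>If 3 divides \<open>q + 1\<close>, all three cube roots of unity lie in
  \<open>U\<close>. Otherwise \<open>u ^ 3 = 1\<close> reduces \<open>u ^ (q + 1) = 1\<close> to
  exponent 1 or 2, forcing \<open>u = 1\<close>.\<close>

lemma card_W: "card W = (if q mod 3 = 2 then 2 else 0)"
proof (cases "q mod 3 = 2")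
  case True
  then have "3 dvd q + 1"
    by presburger
  then obtain c where c: "q + 1 = 3 * c"
    by blast
  have "{x :: 'a. x ^ 3 = 1} \<subseteq> U"
    unfolding U_def c by (auto simp: power_mult)
  then have "W = {x. x ^ 3 = 1} - {1}"
    by (auto simp: W_def)
  moreover have "card {x :: 'a. x ^ 3 = 1} = 3"
  proof (rule card_roots_of_unity)
    have "card (UNIV :: 'a set) - 1 = (q + 1) * (q - 1)"
      unfolding card_UNIV_q by (simp add: power2_eq_square algebra_simps)
    then show "3 dvd card (UNIV :: 'a set) - 1"
      unfolding c by (simp add: mult.assoc)
  qed
  ultimately show ?thesis
    using True by (simp add: card_Diff_singleton)
next
  case False
  have "u = 1" if "u \<in> U" "u ^ 3 = 1" for u
  proof -
    have "(q + 1) mod 3 = 1 \<or> (q + 1) mod 3 = 2"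
      using False by presburger
    moreover have "u ^ (q + 1) = u ^ ((q + 1) mod 3)"
    proof -
      have "u ^ (q + 1) = u ^ (3 * ((q + 1) div 3) + (q + 1) mod 3)"
        by (simp only: mult_div_mod_eq)
      also have "\<dots> = u ^ ((q + 1) mod 3)"
        using that(2) by (simp only: power_add power_mult power_one mult_1)
      finally show ?thesis .
    qed
    ultimately have "u = 1 \<or> u\<^sup>2 = 1"
      using that(1) unfolding U_def by auto
    then show ?thesis
      using that(2) by (auto simp: power2_eq_square power3_eq_cube)
  qed
  then have "W = {}"
    by (auto simp: W_def)
  with False show ?thesis by simp
qed

section \<open>The total count and the spectrum\<close>

text \<open>The non-generic solutions have a coordinate 0 or \<open>- 1\<close>. They form four
  families, related by reflection and swapping, each in bijection with \<open>W\<close>.\<close>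

lemma card_T: "card T = (q - 1) * (q - 3) + 4 * card W"
proof -
  define Z where "Z = (\<lambda>u. (0 :: 'a, - u)) ` W"
  \<comment> \<open>The reflection of \<open>Z\<close>: \<open>(0, - u)\<close> goes to
    \<open>(- 1, u - 1)\<close>.\<close>
  define Z' where "Z' = (\<lambda>u. (- 1 :: 'a, u - 1)) ` W"
  have W: "0 \<notin> W" "1 \<notin> W"
    using U_nonzero by (auto simp: W_def)
  have Z: "z \<in> Z \<longleftrightarrow> z \<in> T \<and> fst z = 0" for z
  proof (cases z)
    case (Pair x y)
    have "z \<in> Z \<longleftrightarrow> x = 0 \<and> - y \<in> W"
      unfolding Z_def Pair by force
    then show ?thesis
      using T_zero_iff Pair by auto
  qed
  have Z': "z \<in> Z' \<longleftrightarrow> z \<in> T \<and> fst z = - 1" for z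
  proof (cases z)
    case (Pair x y)
    have "z \<in> Z' \<longleftrightarrow> x = - 1 \<and> y + 1 \<in> W"
      unfolding Z'_def Pair by force
    moreover have "(- 1, y) \<in> T \<longleftrightarrow> y + 1 \<in> W"
      using T_zero_iff[of "- 1 - y"] reflect_T_iff[of "- 1" y] by simp
    ultimately show ?thesis
      using Pair by auto
  qed
  have S: "z \<in> prod.swap ` A \<longleftrightarrow> prod.swap z \<in> A" for z :: "'a \<times> 'a" and A
    by (force simp: image_iff)
  have swapT: "prod.swap z \<in> T \<longleftrightarrow> z \<in> T" for z
    using swap_T_iff by (cases z) auto
  have split: "T = T_gen \<union> (Z \<union> (Z' \<union> (prod.swap ` Z \<union> prod.swap ` Z')))"
    by (auto simp: T_gen_def Z Z' S swapT swap_T_iff)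
  \<comment> \<open>No solution has both coordinates in \<open>{0, - 1}\<close>, so the four
    families are disjoint.\<close>
  have no: "(0, 0) \<notin> T" "(0, - 1) \<notin> T" "(- 1, 0) \<notin> T" "(- 1, - 1) \<notin> T"
    using T_zero swap_T_iff[of 0 "- 1"] by (blast, blast, blast, simp add: T_def)
  have "card T = card T_gen + (card Z + (card Z' + (card (prod.swap ` Z) + card (prod.swap ` Z'))))"
  proof -
    have "T_gen \<inter> (Z \<union> (Z' \<union> (prod.swap ` Z \<union> prod.swap ` Z'))) = {}"
      by (auto simp: T_gen_def Z Z' S)
    moreover have "Z \<inter> (Z' \<union> (prod.swap ` Z \<union> prod.swap ` Z')) = {}"
      "Z' \<inter> (prod.swap ` Z \<union> prod.swap ` Z') = {}" "prod.swap ` Z \<inter> prod.swap ` Z' = {}"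
      using no by (auto simp: Z Z' S)
    ultimately show ?thesis
      by (subst split) (simp add: card_Un_disjoint del: card_image)
  qed
  moreover have "card Z = card W" "card Z' = card W"
    unfolding Z_def Z'_def by (auto intro!: card_image inj_onI)
  moreover have "card (prod.swap ` A) = card A" for A :: "('a \<times> 'a) set"
    by (simp add: card_image)
  ultimately show ?thesis
    using card_T_gen by simp
qed

lemma spectrum:
  "real (boomerang_spectrum F 2) = (real q - 1) * (real q - 3) / 2 + 2 * real (card W)"
  "real (boomerang_spectrum F 0) = real q ^ 2 - 1 - real (boomerang_spectrum F 2)"
proof -
  have "real (2 * boomerang_spectrum F 2) = real ((q - 1) * (q - 3) + 4 * card W)"
    using spectrum_2 card_T by simp
  then show "real (boomerang_spectrum F 2) = (real q - 1) * (real q - 3) / 2 + 2 * real (card W)"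
    using q_ge_3 by (simp add: of_nat_diff)
  have "real (boomerang_spectrum F 0 + boomerang_spectrum F 2 + 1) = real (q\<^sup>2)"
    using spectrum_0 by simp
  then show "real (boomerang_spectrum F 0) = real q ^ 2 - 1 - real (boomerang_spectrum F 2)"
    by simp
qed

end

theorem theorem4:
  fixes p m k q :: nat
    and F :: "'a::{field,finite} \<Rightarrow> 'a"
  assumes "prime p" and "odd p" and "m > 0" and "k > 0"
    and "q = p ^ m"
    and "card (UNIV :: 'a set) = q\<^sup>2"
    and "gcd k (q + 1) = 1"
    and "F = (\<lambda>x. x ^ (k * (q - 1)))"
  shows "(q mod 3 = 2 \<longrightarrow>
           real (boomerang_spectrum F 0) = (real q ^ 2 - 1) / 2 + 2 * real q - 6 \<and>
           real (boomerang_spectrum F 2) = (real q ^ 2 - 1) / 2 - 2 * real q + 6 \<and>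
           (\<forall>i. i \<notin> {0, 2} \<longrightarrow> boomerang_spectrum F i = 0)) \<and>
         (q mod 3 \<noteq> 2 \<longrightarrow>
           real (boomerang_spectrum F 0) = (real q ^ 2 - 1) / 2 + 2 * (real q - 1) \<and>
           real (boomerang_spectrum F 2) = (real q ^ 2 - 1) / 2 - 2 * (real q - 1) \<and>
           (\<forall>i. i \<notin> {0, 2} \<longrightarrow> boomerang_spectrum F i = 0))"
proof -
  interpret quadratic_power_map p m k q F
    by unfold_locales fact+
  \<comment> \<open>\<open>(q - 1) * (q - 3) / 2\<close> equals
    \<open>(q^2 - 1) / 2 - 2 * (q - 1)\<close>; the cube roots add 4 when
    \<open>q mod 3 = 2\<close>.\<close>
  show ?thesis
    using spectrum spectrum_other by (auto simp: card_W field_simps power2_eq_square)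
qed

end
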